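(* Let $\sigma$ be a non-empty permutation, and let $\alpha$ and $\beta$ be non-empty permutations. Assume that $\sigma$ does not contain any interval copy of a permutation of the form $\alpha'\oplus\beta'$ with $1\le\alpha'\le\alpha$ and $1\le\beta'\le\beta$ (in particular, $\sigma$ has no up-adjacency). Then $\alpha\oplus1\oplus\beta$ is $\sigma$-narrow with $\sigma$-core $\alpha\oplus\beta$, and $\alpha\oplus1\oplus\beta$ is a $\sigma$-annihilator.
   Context: Permutations are ordered by classical pattern containment ($\sigma\le\pi$ if $\pi$ has a subsequence order-isomorphic to $\sigma$); $[\sigma,\pi]$, $[\sigma,\pi)$ denote closed and half-open intervals of this poset; $1$ is the permutation of length one. The Möbius function is $\mu[\sigma,\sigma]=1$, $\mu[\sigma,\pi]=0$ if $\sigma\not\le\pi$, and $\mu[\sigma,\pi]=-\sum_{\lambda\in[\sigma,\pi)}\mu[\sigma,\lambda]$ if $\sigma<\pi$. The direct sum of $\alpha$ (length $m$) and $\beta$ (length $n$) is $\alpha\oplus\beta=\alpha_1,\dots,\alpha_m,\beta_1+m,\dots,\beta_n+m$. A permutation $\pi$ has an interval copy of a permutation $\phi$ if there is a contiguous block of $|\phi|$ positions of $\pi$ whose values form a contiguous set of integers and whose entries are order-isomorphic to $\phi$. An up-adjacency is an interval copy of $12$. A permutation $\phi$ is a $\sigma$-annihilator if every permutation $\pi$ with an interval copy of $\phi$ satisfies $\mu[\sigma,\pi]=0$. A permutation $\phi$ is $\sigma$-narrow if $\phi$ contains a permutation $\phi^-$ of size $|\phi|-1$ such that every permutation in the set $[1,\phi)\setminus[1,\phi^-]$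 is a $\sigma$-annihilator; in this situation $\phi^-$ is called a $\sigma$-core of $\phi$. *)

theory Defs
  imports Complex_Main "HOL-Library.Sublist"
begin

text \<open>
  Permutations are in one-line notation: a permutation of length \<open>n\<close> is a list of length \<open>n\<close>
  containing each of \<open>1, \<dots>, n\<close> exactly once. The empty list is the empty permutation.
\<close>

definition is_perm :: "nat list \<Rightarrow> bool" where
  "is_perm p \<longleftrightarrow> distinct p \<and> set p = {1..length p}"

definition order_iso :: "nat list \<Rightarrow> nat list \<Rightarrow> bool" where
  "order_iso xs ys \<longleftrightarrow> length xs = length ys \<and>
     (\<forall>i<length xs. \<forall>j<length xs. xs ! i < xs ! j \<longleftrightarrow> ys ! i < ys ! j)"

definition perm_le :: "nat list \<Rightarrow> nat list \<Rightarrow> bool"  (infix "\<preceq>" 50) where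
  "\<sigma> \<preceq> \<pi> \<longleftrightarrow> is_perm \<sigma> \<and> is_perm \<pi> \<and> (\<exists>xs. subseq xs \<pi> \<and> order_iso xs \<sigma>)"

definition perm_icc :: "nat list \<Rightarrow> nat list \<Rightarrow> nat list set" where
  "perm_icc \<sigma> \<pi> = {\<tau>. \<sigma> \<preceq> \<tau> \<and> \<tau> \<preceq> \<pi>}"

definition perm_ico :: "nat list \<Rightarrow> nat list \<Rightarrow> nat list set" where
  "perm_ico \<sigma> \<pi> = {\<tau>. \<sigma> \<preceq> \<tau> \<and> \<tau> \<preceq> \<pi> \<and> \<tau> \<noteq> \<pi>}"

lemma perm_nth_eq_card:
  assumes "is_perm p" "i < length p"
  shows "p ! i = card {j. j < length p \<and> p ! j < p ! i} + 1"
proof -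
  have d: "distinct p" and s: "set p = {1..length p}"
    using assms(1) by (auto simp: is_perm_def)
  have pi: "p ! i \<in> {1..length p}"
    using assms(2) s nth_mem by blast
  have im: "(\<lambda>j. p ! j) ` {j. j < length p \<and> p ! j < p ! i} = {1..<p ! i}"
  proof (intro set_eqI iffI)
    fix v assume "v \<in> (\<lambda>j. p ! j) ` {j. j < length p \<and> p ! j < p ! i}"
    then obtain j where j: "j < length p" "p ! j < p ! i" "v = p ! j" by auto
    then have "v \<in> {1..length p}" using s nth_mem by blast
    then show "v \<in> {1..<p ! i}" using j by simp
  next
    fix v assume v: "v \<in> {1..<p ! i}"
    then have "v \<in> set p" using pi s by auto
    then show "v \<in> (\<lambda>j. p ! j) ` {j. j < length p \<and> p ! j < p ! i}"
      using v by (auto simp: in_set_conv_nth)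
  qed
  have "inj_on (\<lambda>j. p ! j) {j. j < length p \<and> p ! j < p ! i}"
    using d by (auto simp: inj_on_def nth_eq_iff_index_eq)
  then have "card {j. j < length p \<and> p ! j < p ! i} = card {1..<p ! i}"
    using im card_image by metis
  then show ?thesis using pi by simp
qed

lemma order_iso_perm_eq:
  assumes "is_perm p" "is_perm q" "order_iso p q"
  shows "p = q"
proof (rule nth_equalityI)
  show len: "length p = length q" using assms(3) by (simp add: order_iso_def)
  fix i assume i: "i < length p"
  have "{j. j < length p \<and> p ! j < p ! i} = {j. j < length q \<and> q ! j < q ! i}"
    using assms(3) i by (auto simp: order_iso_def)
  then show "p ! i = q ! i"
    using perm_nth_eq_card[OF assms(1) i] perm_nth_eq_card[OF assms(2)] i len by simp
qed

lemma perm_le_length: "\<sigma> \<preceq> \<pi> \<Longrightarrow> length \<sigma> \<le> length \<pi>"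
  by (auto simp: perm_le_def order_iso_def dest: list_emb_length)

lemma perm_le_length_eq:
  assumes "\<sigma> \<preceq> \<pi>" "length \<sigma> = length \<pi>"
  shows "\<sigma> = \<pi>"
proof -
  obtain xs where xs: "subseq xs \<pi>" "order_iso xs \<sigma>" and p: "is_perm \<sigma>" "is_perm \<pi>"
    using assms(1) by (auto simp: perm_le_def)
  then have "xs = \<pi>"
    using assms(2) subseq_same_length by (auto simp: order_iso_def)
  with xs p show ?thesis using order_iso_perm_eq by blast
qed

lemma perm_le_refl: "is_perm \<pi> \<Longrightarrow> \<pi> \<preceq> \<pi>"
  by (auto simp: perm_le_def order_iso_def)

lemma perm_le_antisym: "\<sigma> \<preceq> \<pi> \<Longrightarrow> \<pi> \<preceq> \<sigma> \<Longrightarrow> \<sigma> = \<pi>"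
  using perm_le_length perm_le_length_eq by (meson le_antisym)

lemma perm_ico_length: "\<tau> \<in> perm_ico \<sigma> \<pi> \<Longrightarrow> length \<tau> < length \<pi>"
  using perm_le_length perm_le_length_eq by (fastforce simp: perm_ico_def le_less)

lemma finite_perm_icc: "finite (perm_icc \<sigma> \<pi>)"
proof (rule finite_subset)
  show "perm_icc \<sigma> \<pi> \<subseteq> {xs. set xs \<subseteq> {1..length \<pi>} \<and> length xs \<le> length \<pi>}"
  proof
    fix \<tau> assume "\<tau> \<in> perm_icc \<sigma> \<pi>"
    then have "is_perm \<tau>" "length \<tau> \<le> length \<pi>"
      using perm_le_length by (auto simp: perm_icc_def perm_le_def)
    then show "\<tau> \<in> {xs. set xs \<subseteq> {1..length \<pi>} \<and> length xs \<le> length \<pi>}"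
      by (auto simp: is_perm_def)
  qed
qed (simp add: finite_lists_length_le)

lemma finite_perm_ico: "finite (perm_ico \<sigma> \<pi>)"
  by (rule finite_subset[OF _ finite_perm_icc[of \<sigma> \<pi>]]) (auto simp: perm_ico_def perm_icc_def)

function perm_mu :: "nat list \<Rightarrow> nat list \<Rightarrow> int" where
  "perm_mu \<sigma> \<pi> =
     (if \<sigma> = \<pi> then 1
      else if \<not> \<sigma> \<preceq> \<pi> then 0
      else - (\<Sum>\<tau>\<in>perm_ico \<sigma> \<pi>. perm_mu \<sigma> \<tau>))"
  by pat_completeness auto
termination
  by (relation "measure (\<lambda>(\<sigma>, \<pi>). length \<pi>)") (auto intro: perm_ico_length)

declare perm_mu.simps [simp del]

definition direct_sum :: "nat list \<Rightarrow> nat list \<Rightarrow> nat list"  (infixr "\<oplus>" 65) where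
  "\<alpha> \<oplus> \<beta> = \<alpha> @ map (\<lambda>b. b + length \<alpha>) \<beta>"

definition has_interval_copy :: "nat list \<Rightarrow> nat list \<Rightarrow> bool" where
  "has_interval_copy \<pi> \<phi> \<longleftrightarrow>
     (\<exists>xs. sublist xs \<pi> \<and> (\<exists>a. set xs = {a..<a + length \<phi>}) \<and> order_iso xs \<phi>)"

definition annihilator :: "nat list \<Rightarrow> nat list \<Rightarrow> bool" where
  "annihilator \<sigma> \<phi> \<longleftrightarrow>
     is_perm \<phi> \<and> (\<forall>\<pi>. is_perm \<pi> \<and> has_interval_copy \<pi> \<phi> \<longrightarrow> perm_mu \<sigma> \<pi> = 0)"

definition is_core :: "nat list \<Rightarrow> nat list \<Rightarrow> nat list \<Rightarrow> bool" where
  "is_core \<sigma> \<phi> \<phi>' \<longleftrightarrow>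
     \<phi>' \<preceq> \<phi> \<and> length \<phi> = Suc (length \<phi>') \<and>
     (\<forall>\<psi>\<in>perm_ico [1] \<phi> - perm_icc [1] \<phi>'. annihilator \<sigma> \<psi>)"

definition narrow :: "nat list \<Rightarrow> nat list \<Rightarrow> bool" where
  "narrow \<sigma> \<phi> \<longleftrightarrow> (\<exists>\<phi>'. is_core \<sigma> \<phi> \<phi>')"

end

theory Submission
  imports Defs
begin

text \<open>
  Let \<open>\<pi>\<close> have an interval copy of \<open>\<alpha> \<oplus> [1] \<oplus> \<beta>\<close>, and let \<open>\<rho>\<close> be the permutation obtained from \<open>\<pi>\<close> by
  deleting the entry that plays the role of the middle \<open>1\<close>. The values \<open>perm_mu \<sigma> \<tau>\<close> over all
  \<open>\<tau>\<close> in \<open>[\<sigma>, \<rho>]\<close> sum to zero unless \<open>\<sigma> = \<rho>\<close>, so the recursion for \<open>perm_mu \<sigma> \<pi>\<close> only sees those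
  \<open>\<tau> < \<pi>\<close> that do not embed into \<open>\<rho>\<close> (\<open>perm_mu_eq_0_if_lower\<close>).

  An embedding of such a \<open>\<tau>\<close> into \<open>\<pi>\<close> must use the middle entry. It must also use an entry of the
  copy of \<open>\<alpha>\<close>: otherwise the middle entry can be exchanged for any entry of that copy, because the
  copy of \<open>\<alpha> \<oplus> [1] \<oplus> \<beta>\<close> is an interval, and the only other entries used in it belong to the copy of
  \<open>\<beta>\<close>, above and to the right of both. The same applies to \<open>\<beta>\<close>. So \<open>\<tau>\<close> has an interval copy of some \<open>\<alpha>' \<oplus> [1] \<oplus> \<beta>'\<close> with non-empty \<open>\<alpha>' \<le> \<alpha>\<close>
  and \<open>\<beta>' \<le> \<beta>\<close> (\<open>subseq_through_middle\<close>). The hypothesis on \<open>\<sigma>\<close> passes from \<open>\<alpha>, \<beta>\<close> to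
  \<open>\<alpha>', \<beta>'\<close>, and \<open>\<tau>\<close> is shorter than \<open>\<pi>\<close>, so induction on the length of \<open>\<pi>\<close> gives
  \<open>perm_mu \<sigma> \<tau> = 0\<close>. What remains is \<open>\<sigma> \<noteq> \<rho>\<close> and \<open>\<sigma> \<noteq> \<pi>\<close>: \<open>\<rho>\<close> has an
  interval copy of \<open>\<alpha> \<oplus> \<beta>\<close> and \<open>\<pi>\<close> one of \<open>\<alpha> \<oplus> [1]\<close>, both forbidden in \<open>\<sigma>\<close>. This
  is \<open>perm_mu_eq_0_if_block\<close>.

  The same analysis with \<open>\<pi> = \<alpha> \<oplus> [1] \<oplus> \<beta>\<close> shows that every pattern of it which is not a pattern of
  \<open>\<alpha> \<oplus> \<beta>\<close> is itself of the form \<open>\<alpha>' \<oplus> [1] \<oplus> \<beta>'\<close>, hence an annihilator; so \<open>\<alpha> \<oplus> \<beta>\<close> is a core.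

  Subsequences of a permutation are rarely permutations themselves, so the analysis of
  embeddings runs on lists of numbers up to order isomorphism.
\<close>

section \<open>Order isomorphism and pattern containment\<close>

lemma order_iso_refl: "order_iso xs xs"
  by (simp add: order_iso_def)

lemma order_iso_sym: "order_iso xs ys \<Longrightarrow> order_iso ys xs"
  by (auto simp: order_iso_def)

lemma order_iso_trans: "order_iso xs ys \<Longrightarrow> order_iso ys zs \<Longrightarrow> order_iso xs zs"
  by (simp add: order_iso_def)

lemma order_iso_map: "strict_mono_on (set xs) f \<Longrightarrow> order_iso xs (map f xs)"
  by (auto simp: order_iso_def strict_mono_on_less)

text \<open>
  A monotone relabelling of the values acts on all parts of a decomposed list at once, whereas the
  comparison of indices would have to be redone for each part.
\<close>

lemma order_iso_iff_map:
  "order_iso xs ys \<longleftrightarrow> (\<exists>f. strict_mono_on (set xs) f \<and> ys = map f xs)"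
proof
  assume iso: "order_iso xs ys"
  define g where "g x = (SOME i. i < length xs \<and> xs ! i = x)" for x
  define f where "f x = ys ! g x" for x
  have g: "g x < length xs \<and> xs ! g x = x" if "x \<in> set xs" for x
    unfolding g_def by (rule someI_ex) (use that in \<open>auto simp: in_set_conv_nth\<close>)
  have "strict_mono_on (set xs) f"
    using g iso unfolding strict_mono_on_def f_def order_iso_def by metis
  moreover have "ys = map f xs"
  proof (rule nth_equalityI)
    show "length ys = length (map f xs)" using iso by (simp add: order_iso_def)
    fix i assume "i < length ys"
    then have i: "i < length xs" using iso by (simp add: order_iso_def)
    note gi = g[OF nth_mem[OF i]]
    \<comment> \<open>\<open>g (xs ! i)\<close> may differ from \<open>i\<close> when \<open>xs\<close> has repetitions, but equal entries of \<open>xs\<close>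
      correspond to equal entries of \<open>ys\<close>.\<close>
    have "\<not> ys ! i < ys ! g (xs ! i)" "\<not> ys ! g (xs ! i) < ys ! i"
      using iso i gi by (metis less_irrefl order_iso_def)+
    then show "ys ! i = map f xs ! i" using i by (simp add: f_def)
  qed
  ultimately show "\<exists>f. strict_mono_on (set xs) f \<and> ys = map f xs" by blast
qed (auto intro: order_iso_map)

text \<open>Replacing each entry by its rank among the entries standardizes a list.\<close>

lemma ex_perm_order_iso:
  assumes "distinct xs"
  shows "\<exists>p. is_perm p \<and> order_iso xs p"
proof -
  define f where "f x = card {y \<in> set xs. y \<le> x}" for x
  have mono: "strict_mono_on (set xs) f"
    unfolding strict_mono_on_def f_def
  proof (intro allI impI psubset_card_mono)
    fix r s assume "r \<in> set xs \<and> s \<in> set xs \<and> r < s"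
    then have "{y \<in> set xs. y \<le> r} \<subseteq> {y \<in> set xs. y \<le> s}"
        "s \<in> {y \<in> set xs. y \<le> s} - {y \<in> set xs. y \<le> r}" by auto
    then show "{y \<in> set xs. y \<le> r} \<subset> {y \<in> set xs. y \<le> s}" by blast
  qed simp
  have inj: "inj_on f (set xs)" using mono by (rule strict_mono_on_imp_inj_on)
  have sub: "f ` set xs \<subseteq> {1..length xs}"
  proof
    fix v assume "v \<in> f ` set xs"
    then obtain x where x: "x \<in> set xs" "v = f x" by auto
    have "f x \<le> card (set xs)" unfolding f_def by (rule card_mono) auto
    moreover have "f x > 0" unfolding f_def using x by (auto simp: card_gt_0_iff)
    ultimately show "v \<in> {1..length xs}" using x assms by (simp add: distinct_card)
  qed
  have "f ` set xs = {1..length xs}"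
    by (rule card_subset_eq) (use sub inj assms in \<open>auto simp: card_image distinct_card\<close>)
  then have "is_perm (map f xs)"
    using inj assms by (simp add: is_perm_def distinct_map)
  then show ?thesis using order_iso_map[OF mono] by blast
qed

lemma subseq_map_conv: "subseq xs (map f ys) \<longleftrightarrow> (\<exists>zs. subseq zs ys \<and> xs = map f zs)"
proof
  show "subseq xs (map f ys) \<Longrightarrow> \<exists>zs. subseq zs ys \<and> xs = map f zs"
  proof (induction ys arbitrary: xs)
    case (Cons y ys)
    show ?case
    proof (cases "subseq xs (map f ys)")
      case True
      then show ?thesis using Cons.IH by blast
    next
      case False
      then obtain xs' where "xs = f y # xs'" "subseq xs' (map f ys)"
        using Cons.prems by (cases xs) (auto split: if_splits)
      then obtain zs where "subseq zs ys" "xs = map f (y # zs)" using Cons.IH by auto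
      then show ?thesis by (intro exI[of _ "y # zs"]) simp
    qed
  qed (auto dest: list_emb_Nil2)
qed (auto intro: subseq_map)

lemma subseq_order_iso_transfer:
  assumes "order_iso W p" "subseq xs p"
  shows "\<exists>ws. subseq ws W \<and> order_iso ws xs"
proof -
  obtain f where f: "strict_mono_on (set W) f" "p = map f W"
    using assms(1) order_iso_iff_map by blast
  obtain ws where ws: "subseq ws W" "xs = map f ws"
    using assms(2) f(2) by (auto simp: subseq_map_conv)
  have "set ws \<subseteq> set W" using ws(1) by (auto elim: list_emb_set)
  then have "order_iso ws xs"
    using f(1) ws(2) order_iso_map monotone_on_subset by blast
  then show ?thesis using ws(1) by blast
qed

text \<open>
  Containment in \<open>p\<close> can be tested on any list \<open>W\<close> with the same relative order. Below, \<open>W\<close>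
  is a permutation with one entry deleted, whose subsequences are visible, and \<open>p\<close> is its
  standardization.
\<close>

lemma perm_le_iff_of_order_iso:
  assumes "is_perm \<sigma>" "is_perm p" "order_iso W p"
  shows "\<sigma> \<preceq> p \<longleftrightarrow> (\<exists>ws. subseq ws W \<and> order_iso ws \<sigma>)"
  unfolding perm_le_def using assms subseq_order_iso_transfer order_iso_sym order_iso_trans by meson

lemma perm_le_trans: "\<rho> \<preceq> \<sigma> \<Longrightarrow> \<sigma> \<preceq> \<tau> \<Longrightarrow> \<rho> \<preceq> \<tau>"
  using subseq_order_iso_transfer subseq_order.order_trans order_iso_trans unfolding perm_le_def by meson

lemma one_perm_le: 
  assumes "is_perm p" "p \<noteq> []" 
  shows "[1] \<preceq> p"
proof -
  have "subseq [hd p] p" using assms(2) by (cases p) auto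
  moreover have "order_iso [hd p] [1]" by (simp add: order_iso_def)
  moreover have "is_perm [1]" by (simp add: is_perm_def)
  ultimately show ?thesis using assms(1) unfolding perm_le_def by blast
qed

section \<open>Direct sums\<close>

lemma is_perm_direct_sum:
  assumes "is_perm \<alpha>" "is_perm \<beta>"
  shows "is_perm (\<alpha> \<oplus> \<beta>)"
proof -
  have "(\<lambda>b. b + length \<alpha>) ` {1..length \<beta>} = {Suc (length \<alpha>)..length \<alpha> + length \<beta>}"
    using image_add_atLeastAtMost'[of "length \<alpha>" 1 "length \<beta>"] by (simp add: add.commute)
  then show ?thesis
    using assms by (auto simp: is_perm_def direct_sum_def distinct_map inj_on_def)
qed

text \<open>
  Up to order isomorphism, the shift in \<open>\<alpha> \<oplus> \<beta>\<close> only records that the second part lies above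
  the first. From right to left, the relabellings of the two parts are glued at the value
  \<open>length \<alpha>\<close>.
\<close>

lemma order_iso_direct_sum_iff:
  assumes "is_perm \<alpha>" "is_perm \<beta>"
  shows "order_iso xs (\<alpha> \<oplus> \<beta>) \<longleftrightarrow>
    (\<exists>A B. xs = A @ B \<and> order_iso A \<alpha> \<and> order_iso B \<beta> \<and> (\<forall>a\<in>set A. \<forall>b\<in>set B. a < b))"
proof
  assume "order_iso xs (\<alpha> \<oplus> \<beta>)"
  then obtain f where f: "strict_mono_on (set (\<alpha> \<oplus> \<beta>)) f" "xs = map f (\<alpha> \<oplus> \<beta>)"
    using order_iso_iff_map order_iso_sym by meson
  let ?g = "\<lambda>b. f (b + length \<alpha>)"
  have "strict_mono_on (set \<alpha>) f" "strict_mono_on (set \<beta>) ?g"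
    using f(1) by (auto simp: strict_mono_on_def direct_sum_def)
  moreover have "\<forall>a\<in>set \<alpha>. \<forall>b\<in>set \<beta>. f a < ?g b"
  proof (intro ballI)
    fix a b assume "a \<in> set \<alpha>" "b \<in> set \<beta>"
    moreover from this have "a < b + length \<alpha>" using assms by (auto simp: is_perm_def)
    ultimately show "f a < ?g b" using f(1) by (auto simp: strict_mono_on_def direct_sum_def)
  qed
  moreover have "xs = map f \<alpha> @ map ?g \<beta>" using f(2) by (simp add: direct_sum_def)
  ultimately show "\<exists>A B. xs = A @ B \<and> order_iso A \<alpha> \<and> order_iso B \<beta> \<and> (\<forall>a\<in>set A. \<forall>b\<in>set B. a < b)"
    by (intro exI[of _ "map f \<alpha>"] exI[of _ "map ?g \<beta>"]) (auto intro: order_iso_map order_iso_sym)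
next
  assume "\<exists>A B. xs = A @ B \<and> order_iso A \<alpha> \<and> order_iso B \<beta> \<and> (\<forall>a\<in>set A. \<forall>b\<in>set B. a < b)"
  then obtain A B where AB: "xs = A @ B" "order_iso \<alpha> A" "order_iso \<beta> B"
      "\<forall>a\<in>set A. \<forall>b\<in>set B. a < b" using order_iso_sym by blast
  obtain f where f: "strict_mono_on (set \<alpha>) f" "A = map f \<alpha>"
    using AB(2) order_iso_iff_map by blast
  obtain g where g: "strict_mono_on (set \<beta>) g" "B = map g \<beta>"
    using AB(3) order_iso_iff_map by blast
  have fg: "xs = map f \<alpha> @ map g \<beta>" "\<forall>a\<in>set \<alpha>. \<forall>b\<in>set \<beta>. f a < g b"
    using AB(1,4) f(2) g(2) by auto
  define h where "h v = (if v \<le> length \<alpha> then f v else g (v - length \<alpha>))" for v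
  have ha: "h v = f v" if "v \<in> set \<alpha>" for v
    using that assms(1) by (auto simp: h_def is_perm_def)
  have hb: "h (v + length \<alpha>) = g v" if "v \<in> set \<beta>" for v
    using that assms(2) by (auto simp: h_def is_perm_def)
  have lt: "a < b + length \<alpha>" if "a \<in> set \<alpha>" "b \<in> set \<beta>" for a b
    using that assms by (auto simp: is_perm_def)
  have "strict_mono_on (set (\<alpha> \<oplus> \<beta>)) h"
    unfolding strict_mono_on_def
  proof (intro allI impI)
    fix v w assume "v \<in> set (\<alpha> \<oplus> \<beta>) \<and> w \<in> set (\<alpha> \<oplus> \<beta>) \<and> v < w"
    then consider "v \<in> set \<alpha>" "w \<in> set \<alpha>" "v < w"
      | w' where "v \<in> set \<alpha>" "w' \<in> set \<beta>" "w = w' + length \<alpha>"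
      | v' where "v' \<in> set \<beta>" "v = v' + length \<alpha>" "w \<in> set \<alpha>" "v < w"
      | v' w' where "v' \<in> set \<beta>" "v = v' + length \<alpha>" "w' \<in> set \<beta>" "w = w' + length \<alpha>" "v' < w'"
      by (auto simp: direct_sum_def)
    then show "h v < h w"
    proof cases
      case 1
      then show ?thesis using f(1) ha by (simp add: strict_mono_on_def)
    next
      case 2
      then show ?thesis using fg(2) ha hb by simp
    next
      case 3
      then show ?thesis using lt by (meson less_asym)
    next
      case 4
      then show ?thesis using g(1) hb by (simp add: strict_mono_on_def)
    qed
  qed
  moreover have "map h (\<alpha> \<oplus> \<beta>) = xs" using ha hb fg(1) by (auto simp: direct_sum_def)
  ultimately show "order_iso xs (\<alpha> \<oplus> \<beta>)" using order_iso_map order_iso_sym by metis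
qed

lemma order_iso_sum_one_sum_iff:
  assumes "is_perm \<alpha>" "is_perm \<beta>"
  shows "order_iso xs (\<alpha> \<oplus> [1] \<oplus> \<beta>) \<longleftrightarrow>
    (\<exists>A c B. xs = A @ c # B \<and> order_iso A \<alpha> \<and> order_iso B \<beta> \<and>
       (\<forall>a\<in>set A. a < c) \<and> (\<forall>b\<in>set B. c < b))"
proof -
  have one: "is_perm [1]" by (simp add: is_perm_def)
  have single: "order_iso C [1] \<longleftrightarrow> (\<exists>c. C = [c])" for C
    by (auto simp: order_iso_def length_Suc_conv)
  show ?thesis
    unfolding order_iso_direct_sum_iff[OF assms(1) is_perm_direct_sum[OF one assms(2)]]
      order_iso_direct_sum_iff[OF one assms(2)] single
  proof (safe, goal_cases)
    case (1 A B C B' c)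
    then show ?case by (intro exI[of _ A] exI[of _ c] exI[of _ B']) auto
  next
    case (2 A c B)
    then show ?case
      by (intro exI[of _ A] exI[of _ "c # B"] conjI exI[of _ "[c]"] exI[of _ B])
        (auto dest: less_trans)
  qed
qed

section \<open>Interval copies in arbitrary lists\<close>

definition separated :: "nat set \<Rightarrow> nat set \<Rightarrow> bool" where
  "separated V I \<longleftrightarrow> (\<forall>v\<in>V. (\<forall>i\<in>I. v < i) \<or> (\<forall>i\<in>I. i < v))"

lemma separated_mono: "separated V I \<Longrightarrow> W \<subseteq> V \<Longrightarrow> J \<subseteq> I \<Longrightarrow> separated W J"
  unfolding separated_def by blast

lemma separated_Un_left: "separated (V \<union> W) I \<longleftrightarrow> separated V I \<and> separated W I"
  unfolding separated_def by blast

lemma separated_if_above: "\<forall>v\<in>V. \<forall>i\<in>I. i < v \<Longrightarrow> separated V I"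
  unfolding separated_def by blast

lemma separated_if_below: "\<forall>v\<in>V. \<forall>i\<in>I. v < i \<Longrightarrow> separated V I"
  unfolding separated_def by blast

text \<open>
  For a list that is not a permutation, its values need not be consecutive numbers. A block
  therefore only requires that no outside entry has a value between two values of the block, which
  is preserved by order isomorphism.
\<close>

definition has_block :: "nat list \<Rightarrow> nat list \<Rightarrow> bool" where
  "has_block xs \<phi> \<longleftrightarrow>
     (\<exists>P I S. xs = P @ I @ S \<and> separated (set P \<union> set S) (set I) \<and> order_iso I \<phi>)"

lemma has_block_order_iso:
  assumes "order_iso xs ys" "has_block xs \<phi>"
  shows "has_block ys \<phi>"
proof -
  obtain f where f: "strict_mono_on (set xs) f" "ys = map f xs"
    using assms(1) order_iso_iff_map by blast
  obtain P I S where xs: "xs = P @ I @ S" "separated (set P \<union> set S) (set I)" "order_iso I \<phi>"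
    using assms(2) by (auto simp: has_block_def)
  have fless: "f u < f v" if "u < v" "u \<in> set xs" "v \<in> set xs" for u v
    using f(1) that by (auto simp: strict_mono_on_def)
  have "separated (f ` (set P \<union> set S)) (f ` set I)"
    unfolding separated_def
  proof
    fix w assume "w \<in> f ` (set P \<union> set S)"
    then obtain v where v: "v \<in> set P \<union> set S" "w = f v" by blast
    then have "(\<forall>i\<in>set I. v < i) \<or> (\<forall>i\<in>set I. i < v)"
      using xs(2) unfolding separated_def by blast
    then show "(\<forall>i\<in>f ` set I. w < i) \<or> (\<forall>i\<in>f ` set I. i < w)"
      using v xs(1) by (elim disjE) (auto intro!: fless)
  qed
  moreover have "order_iso (map f I) \<phi>"
  proof -
    have "strict_mono_on (set I) f" using f(1) xs(1) by (auto simp: strict_mono_on_def)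
    then show ?thesis using order_iso_map order_iso_sym order_iso_trans xs(3) by meson
  qed
  ultimately show ?thesis
    unfolding has_block_def f(2) xs(1)
    by (intro exI[of _ "map f P"] exI[of _ "map f I"] exI[of _ "map f S"]) (simp add: image_Un)
qed

text \<open>
  In a permutation every value between the minimum and the maximum of a block occurs, and
  separation forces it to occur inside the block.
\<close>

lemma has_interval_copy_iff_has_block:
  assumes "is_perm \<pi>"
  shows "has_interval_copy \<pi> \<phi> \<longleftrightarrow> has_block \<pi> \<phi>"
proof
  assume "has_interval_copy \<pi> \<phi>"
  then obtain P I S a where d: "\<pi> = P @ I @ S" "set I = {a..<a + length \<phi>}" "order_iso I \<phi>"
    by (auto simp: has_interval_copy_def sublist_def)
  have "(set P \<union> set S) \<inter> set I = {}" using assms d(1) by (auto simp: is_perm_def)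
  then have "separated (set P \<union> set S) (set I)"
    unfolding separated_def d(2) by (fastforce simp: disjoint_iff)
  then show "has_block \<pi> \<phi>" unfolding has_block_def using d by blast
next
  assume "has_block \<pi> \<phi>"
  then obtain P I S where d: "\<pi> = P @ I @ S" "separated (set P \<union> set S) (set I)" "order_iso I \<phi>"
    by (auto simp: has_block_def)
  have len: "card (set I) = length \<phi>"
    using assms d(1,3) by (simp add: is_perm_def order_iso_def distinct_card)
  have "\<exists>a. set I = {a..<a + length \<phi>}"
  proof (cases "I = []")
    case True
    then show ?thesis using d(3) by (simp add: order_iso_def)
  next
    case False
    let ?a = "Min (set I)" and ?b = "Max (set I)"
    have mm: "?a \<in> set I" "?b \<in> set I" using False by auto
    have "set I = {?a..?b}"
    proof
      show "set I \<subseteq> {?a..?b}" by auto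
      show "{?a..?b} \<subseteq> set I"
      proof
        fix v assume v: "v \<in> {?a..?b}"
        then have "v \<in> set \<pi>"
          using mm assms d(1) unfolding is_perm_def
          by (metis Un_iff atLeastAtMost_iff order_trans set_append)
        moreover have "v \<notin> set P \<union> set S"
        proof
          assume "v \<in> set P \<union> set S"
          then have "v < ?a \<or> ?b < v" using d(2) mm unfolding separated_def by blast
          then show False using v by auto
        qed
        ultimately show "v \<in> set I" using d(1) by auto
      qed
    qed
    moreover from this have "Suc ?b - ?a = length \<phi>" using len by (metis card_atLeastAtMost)
    moreover have "?a \<le> ?b" using mm by simp
    ultimately have "Suc ?b = ?a + length \<phi>" "set I = {?a..<Suc ?b}"
      by (simp_all only: atLeastLessThanSuc_atLeastAtMost)
    then have "set I = {?a..<?a + length \<phi>}" by (simp only:)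
    then show ?thesis by blast
  qed
  then show "has_interval_copy \<pi> \<phi>"
    unfolding has_interval_copy_def using d(1,3) by (auto simp: sublist_def)
qed

section \<open>Embeddings that cannot avoid the middle entry\<close>

text \<open>
  If no value of \<open>P\<close> or \<open>S\<close> lies between \<open>a\<close> and \<open>c\<close>, the two are indistinguishable in this context.
\<close>

lemma order_iso_exchange:
  assumes "separated (set P \<union> set S) {a, c}"
  shows "order_iso (P @ c # S) (P @ a # S)"
proof -
  let ?f = "\<lambda>v. if v = c then a else v"
  have c: "c \<notin> set P \<union> set S" using assms by (auto simp: separated_def)
  then have "P @ a # S = map ?f (P @ c # S)" by (auto intro: map_idI[symmetric])
  moreover have "strict_mono_on (set (P @ c # S)) ?f"
    unfolding strict_mono_on_def
  proof (intro allI impI)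
    have sep: "v < a \<and> v < c \<or> a < v \<and> c < v" if "v \<in> set P \<union> set S" for v
      using assms that unfolding separated_def by blast
    fix v w assume "v \<in> set (P @ c # S) \<and> w \<in> set (P @ c # S) \<and> v < w"
    then have "v = c \<or> v \<in> set P \<union> set S" "w = c \<or> w \<in> set P \<union> set S" "v < w" by auto
    then show "?f v < ?f w" using sep[of v] sep[of w] by auto
  qed
  ultimately show ?thesis using order_iso_map by metis
qed

text \<open>
  A subsequence that misses \<open>A\<close> but uses \<open>c\<close> can use an entry of \<open>A\<close> in place of \<open>c\<close>: the entries it
  uses in \<open>B\<close> exceed both, and those in \<open>P\<close> and \<open>S\<close> do not separate them. The same exchange works
  for a subsequence that misses \<open>B\<close>. Only subsequences that meet \<open>A\<close>, \<open>c\<close> and \<open>B\<close> can fail to have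
  a copy in the list without \<open>c\<close>.
\<close>

lemma subseq_through_middle:
  assumes sub: "subseq xs (P @ A @ c # B @ S)"
    and sep: "separated (set P \<union> set S) (set (A @ c # B))"
    and lt: "\<forall>a\<in>set A. a < c" "\<forall>b\<in>set B. c < b"
    and ne: "A \<noteq> []" "B \<noteq> []"
  obtains (avoid) ys where "subseq ys (P @ A @ B @ S)" "order_iso ys xs"
  | (middle) P' A' B' S' where "xs = P' @ A' @ c # B' @ S'" "subseq P' P" "subseq A' A"
      "subseq B' B" "subseq S' S" "A' \<noteq> []" "B' \<noteq> []"
proof -
  obtain P' A' C' B' S' where xs: "xs = P' @ A' @ C' @ B' @ S'" "subseq P' P" "subseq A' A"
      "subseq C' [c]" "subseq B' B" "subseq S' S"
  proof -
    have "subseq xs (P @ A @ [c] @ B @ S)" using sub by simp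
    then show ?thesis using that unfolding subseq_append_iff by blast
  qed
  have sets: "set P' \<subseteq> set P" "set A' \<subseteq> set A" "set B' \<subseteq> set B" "set S' \<subseteq> set S"
    using xs by (auto elim: list_emb_set)
  consider "C' = []" | "C' = [c]" "A' = []" | "C' = [c]" "B' = []" | "C' = [c]" "A' \<noteq> []" "B' \<noteq> []"
    using xs(4) by (cases C') (auto split: if_splits)
  then show thesis
  proof cases
    case 1
    then have "subseq xs (P @ A @ B @ S)" using xs by (simp add: list_emb_append_mono)
    then show thesis using avoid order_iso_refl by blast
  next
    case 2
    obtain a where a: "a \<in> set A" using ne(1) by (cases A) auto
    have "separated (set P' \<union> set S') {a, c}"
      by (rule separated_mono[OF sep]) (use sets a in auto)
    moreover have "separated (set B') {a, c}"
      using sets(3) lt a by (intro separated_if_above) (auto intro: less_trans)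
    ultimately have "separated (set P' \<union> set (B' @ S')) {a, c}"
      by (simp add: separated_Un_left)
    then have "order_iso (P' @ c # B' @ S') (P' @ a # B' @ S')" by (rule order_iso_exchange)
    moreover have "subseq (P' @ [a] @ B' @ S') (P @ A @ B @ S)"
      by (intro list_emb_append_mono) (use xs a in \<open>auto simp: subseq_singleton_left\<close>)
    ultimately show thesis using avoid[of "P' @ a # B' @ S'"] 2 xs(1) order_iso_sym by simp
  next
    case 3
    obtain b where b: "b \<in> set B" using ne(2) by (cases B) auto
    have "separated (set P' \<union> set S') {b, c}"
      by (rule separated_mono[OF sep]) (use sets b in auto)
    moreover have "separated (set A') {b, c}"
      using sets(2) lt b by (intro separated_if_below) (auto intro: less_trans)
    ultimately have "separated (set (P' @ A') \<union> set S') {b, c}"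
      by (simp add: separated_Un_left)
    then have "order_iso ((P' @ A') @ c # S') ((P' @ A') @ b # S')" by (rule order_iso_exchange)
    moreover have "subseq (P' @ A' @ [b] @ S') (P @ A @ B @ S)"
      by (intro list_emb_append_mono) (use xs b in \<open>auto simp: subseq_singleton_left\<close>)
    ultimately show thesis using avoid[of "P' @ A' @ b # S'"] 3 xs(1) order_iso_sym by simp
  next
    case 4
    then show thesis using middle xs by auto
  qed
qed

section \<open>Zeros of the Moebius function\<close>

lemma perm_mu_sum_icc:
  assumes "\<sigma> \<noteq> \<pi>" "is_perm \<pi>"
  shows "(\<Sum>\<tau>\<in>perm_icc \<sigma> \<pi>. perm_mu \<sigma> \<tau>) = 0"
proof (cases "\<sigma> \<preceq> \<pi>")
  case True
  have "perm_icc \<sigma> \<pi> = insert \<pi> (perm_ico \<sigma> \<pi>)" "\<pi> \<notin> perm_ico \<sigma> \<pi>"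
    using True assms by (auto simp: perm_icc_def perm_ico_def perm_le_refl)
  then show ?thesis
    using True assms finite_perm_ico[of \<sigma> \<pi>] perm_mu.simps[of \<sigma> \<pi>] by simp
next
  case False
  then have "perm_icc \<sigma> \<pi> = {}" using perm_le_trans by (auto simp: perm_icc_def)
  then show ?thesis by simp
qed

text \<open>
  In the recursion for \<open>perm_mu \<sigma> \<pi>\<close> the terms below \<open>\<rho>\<close> cancel among themselves, since they sum to
  zero over the closed interval from \<open>\<sigma>\<close> to \<open>\<rho>\<close>.
\<close>

lemma perm_mu_eq_0_if_lower:
  assumes "\<sigma> \<noteq> \<pi>" "\<sigma> \<noteq> \<rho>" "\<rho> \<preceq> \<pi>" "\<rho> \<noteq> \<pi>"
    and zero: "\<And>\<tau>. \<sigma> \<preceq> \<tau> \<Longrightarrow> \<tau> \<preceq> \<pi> \<Longrightarrow> \<tau> \<noteq> \<pi> \<Longrightarrow> \<not> \<tau> \<preceq> \<rho> \<Longrightarrow> perm_mu \<sigma> \<tau> = 0"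
  shows "perm_mu \<sigma> \<pi> = 0"
proof (cases "\<sigma> \<preceq> \<pi>")
  case True
  have "(\<Sum>\<tau>\<in>perm_icc \<sigma> \<rho>. perm_mu \<sigma> \<tau>) = (\<Sum>\<tau>\<in>perm_ico \<sigma> \<pi>. perm_mu \<sigma> \<tau>)"
  proof (rule sum.mono_neutral_left[OF finite_perm_ico])
    show "perm_icc \<sigma> \<rho> \<subseteq> perm_ico \<sigma> \<pi>"
      using assms(3,4) perm_le_trans perm_le_antisym by (auto simp: perm_icc_def perm_ico_def)
    show "\<forall>\<tau>\<in>perm_ico \<sigma> \<pi> - perm_icc \<sigma> \<rho>. perm_mu \<sigma> \<tau> = 0"
      using zero by (auto simp: perm_icc_def perm_ico_def)
  qed
  moreover have "(\<Sum>\<tau>\<in>perm_icc \<sigma> \<rho>. perm_mu \<sigma> \<tau>) = 0"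
    using assms(2,3) by (intro perm_mu_sum_icc) (auto simp: perm_le_def)
  ultimately show ?thesis using True assms(1) perm_mu.simps[of \<sigma> \<pi>] by simp
next
  case False
  then show ?thesis using assms(1) perm_mu.simps[of \<sigma> \<pi>] by simp
qed

text \<open>
  The hypothesis on \<open>\<sigma>\<close>, phrased with \<open>has_block\<close>. It is inherited by patterns of \<open>\<alpha>\<close> and \<open>\<beta>\<close>,
  which is what makes the induction below possible.
\<close>

definition avoids_sum_copies :: "nat list \<Rightarrow> nat list \<Rightarrow> nat list \<Rightarrow> bool" where
  "avoids_sum_copies \<sigma> \<alpha> \<beta> \<longleftrightarrow>
     (\<forall>\<alpha>'\<in>perm_icc [1] \<alpha>. \<forall>\<beta>'\<in>perm_icc [1] \<beta>. \<not> has_block \<sigma> (\<alpha>' \<oplus> \<beta>'))"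

lemma avoids_sum_copies_mono:
  "avoids_sum_copies \<sigma> \<alpha> \<beta> \<Longrightarrow> \<alpha>' \<preceq> \<alpha> \<Longrightarrow> \<beta>' \<preceq> \<beta> \<Longrightarrow> avoids_sum_copies \<sigma> \<alpha>' \<beta>'"
  unfolding avoids_sum_copies_def perm_icc_def using perm_le_trans by blast

lemma subseq_distinct: "subseq xs ys \<Longrightarrow> distinct ys \<Longrightarrow> distinct xs"
  by (auto simp: subseq_conv_nths)

lemma subseq_pattern:
  assumes "subseq xs p" "order_iso p \<pi>" "is_perm \<pi>" "distinct p" "xs \<noteq> []"
  obtains \<rho> where "\<rho> \<preceq> \<pi>" "is_perm \<rho>" "\<rho> \<noteq> []" "order_iso xs \<rho>"
proof -
  obtain \<rho> where \<rho>: "is_perm \<rho>" "order_iso xs \<rho>"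
    using ex_perm_order_iso subseq_distinct[OF assms(1,4)] by blast
  moreover have "\<rho> \<preceq> \<pi>" using perm_le_iff_of_order_iso[OF \<rho>(1) assms(3,2)] assms(1) \<rho>(2) by blast
  moreover have "\<rho> \<noteq> []" using \<rho>(2) assms(5) by (auto simp: order_iso_def)
  ultimately show thesis using that by blast
qed

text \<open>
  The induction is on the length of \<open>\<pi>\<close> with \<open>\<alpha>\<close> and \<open>\<beta>\<close> arbitrary, as the permutations below \<open>\<pi>\<close>
  that matter contain an interval copy of a smaller sum \<open>\<alpha>' \<oplus> [1] \<oplus> \<beta>'\<close>.
\<close>

lemma perm_mu_eq_0_if_block:
  assumes "is_perm \<alpha>" "\<alpha> \<noteq> []" "is_perm \<beta>" "\<beta> \<noteq> []"
    and "is_perm \<pi>" "has_block \<pi> (\<alpha> \<oplus> [1] \<oplus> \<beta>)" "avoids_sum_copies \<sigma> \<alpha> \<beta>"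
  shows "perm_mu \<sigma> \<pi> = 0"
  using assms
proof (induction "length \<pi>" arbitrary: \<alpha> \<beta> \<pi> rule: less_induct)
  case less
  note perms = less.prems(1-5)
  obtain P I S where I: "\<pi> = P @ I @ S" "separated (set P \<union> set S) (set I)"
      "order_iso I (\<alpha> \<oplus> [1] \<oplus> \<beta>)"
    using less.prems(6) unfolding has_block_def by blast
  obtain A c B where AB: "I = A @ c # B" "order_iso A \<alpha>" "order_iso B \<beta>"
      "\<forall>a\<in>set A. a < c" "\<forall>b\<in>set B. c < b"
    using I(3) perms unfolding order_iso_sum_one_sum_iff[OF perms(1,3)] by blast
  have \<pi>: "\<pi> = P @ A @ c # B @ S" using I(1) AB(1) by simp
  have ne: "A \<noteq> []" "B \<noteq> []" using AB(2,3) perms by (auto simp: order_iso_def)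
  have dist: "distinct \<pi>" using perms by (simp add: is_perm_def)
  have AltB: "\<forall>a\<in>set A. \<forall>b\<in>set B. a < b" using AB(4,5) less_trans by blast
  \<comment> \<open>\<open>W\<close> is \<open>\<pi>\<close> without its middle entry, and \<open>\<rho>\<close> is its standardization.\<close>
  define W where "W = P @ A @ B @ S"
  have W_sub: "subseq W \<pi>" unfolding W_def \<pi> by (intro list_emb_append_mono) auto
  then obtain \<rho> where \<rho>: "is_perm \<rho>" "order_iso W \<rho>"
    using ex_perm_order_iso subseq_distinct dist by blast
  have "\<rho> \<preceq> \<pi>" unfolding perm_le_def using \<rho> perms W_sub by blast
  have "length \<rho> < length \<pi>" using \<rho>(2) by (simp add: order_iso_def W_def \<pi>)
  show ?case
  proof (rule perm_mu_eq_0_if_lower[OF _ _ \<open>\<rho> \<preceq> \<pi>\<close>])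
    show "\<rho> \<noteq> \<pi>" using \<open>length \<rho> < length \<pi>\<close> by auto
    have \<alpha>: "\<alpha> \<in> perm_icc [1] \<alpha>" and \<beta>: "\<beta> \<in> perm_icc [1] \<beta>"
      using perms by (auto simp: perm_icc_def one_perm_le perm_le_refl simp del: One_nat_def)
    have "has_block W (\<alpha> \<oplus> \<beta>)"
      unfolding has_block_def
    proof (intro exI conjI)
      show "W = P @ (A @ B) @ S" by (simp add: W_def)
      show "separated (set P \<union> set S) (set (A @ B))"
        by (rule separated_mono[OF I(2)]) (use AB(1) in auto)
      show "order_iso (A @ B) (\<alpha> \<oplus> \<beta>)"
        using AB(2,3) AltB unfolding order_iso_direct_sum_iff[OF perms(1,3)] by blast
    qed
    then have "has_block \<rho> (\<alpha> \<oplus> \<beta>)" using has_block_order_iso \<rho>(2) by blast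
    then show "\<sigma> \<noteq> \<rho>" using less.prems(7) \<alpha> \<beta> unfolding avoids_sum_copies_def by blast
    \<comment> \<open>The copy of \<open>\<alpha>\<close> and the middle entry form an interval, as all of \<open>B\<close> lies above them.\<close>
    have "has_block \<pi> (\<alpha> \<oplus> [1])"
      unfolding has_block_def
    proof (intro exI conjI)
      show "\<pi> = P @ (A @ [c]) @ (B @ S)" by (simp add: \<pi>)
      have "separated (set P \<union> set S) (set (A @ [c]))"
        by (rule separated_mono[OF I(2)]) (use AB(1) in auto)
      moreover have "separated (set B) (set (A @ [c]))"
        using AltB AB(5) by (intro separated_if_above) auto
      ultimately show "separated (set P \<union> set (B @ S)) (set (A @ [c]))"
        by (simp add: separated_Un_left)
      have one: "order_iso [c] [1]" "is_perm [1]" by (simp_all add: order_iso_def is_perm_def)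
      show "order_iso (A @ [c]) (\<alpha> \<oplus> [1])"
        unfolding order_iso_direct_sum_iff[OF perms(1) one(2)]
        using AB(2,4) one(1) by (intro exI[of _ A] exI[of _ "[c]"]) simp
    qed
    moreover have "[1] \<in> perm_icc [1] \<beta>"
      using \<beta> by (auto simp: perm_icc_def perm_le_refl is_perm_def)
    ultimately show "\<sigma> \<noteq> \<pi>" using less.prems(7) \<alpha> unfolding avoids_sum_copies_def by blast
  next
    fix \<tau> assume \<tau>: "\<sigma> \<preceq> \<tau>" "\<tau> \<preceq> \<pi>" "\<tau> \<noteq> \<pi>" "\<not> \<tau> \<preceq> \<rho>"
    have \<tau>p: "is_perm \<tau>" using \<tau> by (simp add: perm_le_def)
    obtain xs where xs: "subseq xs \<pi>" "order_iso xs \<tau>" using \<tau>(2) by (auto simp: perm_le_def)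
    from xs(1)[unfolded \<pi>] I(2)[unfolded AB(1)] AB(4,5) ne
    show "perm_mu \<sigma> \<tau> = 0"
    proof (cases rule: subseq_through_middle)
      case (avoid ys)
      then have "\<tau> \<preceq> \<rho>"
        using perm_le_iff_of_order_iso[OF \<tau>p \<rho>] xs(2) order_iso_trans unfolding W_def by blast
      then show ?thesis using \<tau>(4) by blast
    next
      case (middle P' A' B' S')
      have sets: "set P' \<subseteq> set P" "set A' \<subseteq> set A" "set B' \<subseteq> set B" "set S' \<subseteq> set S"
        using middle by (auto elim: list_emb_set)
      have dAB: "distinct A" "distinct B" using dist \<pi> by auto
      obtain \<alpha>' where \<alpha>': "\<alpha>' \<preceq> \<alpha>" "is_perm \<alpha>'" "\<alpha>' \<noteq> []" "order_iso A' \<alpha>'"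
        using subseq_pattern[OF middle(3) AB(2) perms(1) dAB(1) middle(6)] .
      obtain \<beta>' where \<beta>': "\<beta>' \<preceq> \<beta>" "is_perm \<beta>'" "\<beta>' \<noteq> []" "order_iso B' \<beta>'"
        using subseq_pattern[OF middle(4) AB(3) perms(3) dAB(2) middle(7)] .
      have "has_block xs (\<alpha>' \<oplus> [1] \<oplus> \<beta>')"
        unfolding has_block_def
      proof (intro exI conjI)
        show "xs = P' @ (A' @ c # B') @ S'" using middle(1) by simp
        show "separated (set P' \<union> set S') (set (A' @ c # B'))"
          by (rule separated_mono[OF I(2)]) (use AB(1) sets in auto)
        show "order_iso (A' @ c # B') (\<alpha>' \<oplus> [1] \<oplus> \<beta>')"
          using \<alpha>'(4) \<beta>'(4) sets AB(4,5)
          unfolding order_iso_sum_one_sum_iff[OF \<alpha>'(2) \<beta>'(2)] by blast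
      qed
      then have "has_block \<tau> (\<alpha>' \<oplus> [1] \<oplus> \<beta>')" using has_block_order_iso xs(2) by blast
      moreover have "length \<tau> < length \<pi>"
        using \<tau>(2,3) perm_le_length perm_le_length_eq le_neq_implies_less by blast
      moreover have "avoids_sum_copies \<sigma> \<alpha>' \<beta>'"
        using avoids_sum_copies_mono less.prems(7) \<alpha>'(1) \<beta>'(1) by blast
      ultimately show ?thesis using less.hyps \<alpha>' \<beta>' \<tau>p by blast
    qed
  qed
qed

lemma annihilator_sum_one_sum:
  assumes "is_perm \<alpha>" "\<alpha> \<noteq> []" "is_perm \<beta>" "\<beta> \<noteq> []" "avoids_sum_copies \<sigma> \<alpha> \<beta>"
  shows "annihilator \<sigma> (\<alpha> \<oplus> [1] \<oplus> \<beta>)"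
proof -
  have "is_perm [1]" by (simp add: is_perm_def)
  then have "is_perm (\<alpha> \<oplus> [1] \<oplus> \<beta>)" using assms by (intro is_perm_direct_sum)
  then show ?thesis
    unfolding annihilator_def
    using perm_mu_eq_0_if_block[OF assms(1-4)] assms(5) has_interval_copy_iff_has_block by blast
qed

section \<open>The core\<close>

text \<open>
  This is the exchange argument with nothing outside the interval, so that the embedded
  permutation is the smaller sum itself and does not merely have an interval copy of it.
\<close>

lemma pattern_of_sum_one_sum:
  assumes "is_perm \<alpha>" "\<alpha> \<noteq> []" "is_perm \<beta>" "\<beta> \<noteq> []"
    and "\<psi> \<preceq> \<alpha> \<oplus> [1] \<oplus> \<beta>" "\<not> \<psi> \<preceq> \<alpha> \<oplus> \<beta>"
  obtains \<alpha>' \<beta>' where "\<psi> = \<alpha>' \<oplus> [1] \<oplus> \<beta>'" "\<alpha>' \<preceq> \<alpha>" "\<alpha>' \<noteq> []" "\<beta>' \<preceq> \<beta>" "\<beta>' \<noteq> []"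
proof -
  have one: "is_perm [1]" by (simp add: is_perm_def)
  have \<psi>: "is_perm \<psi>" and \<phi>: "is_perm (\<alpha> \<oplus> [1] \<oplus> \<beta>)"
    using assms(5) by (auto simp: perm_le_def)
  obtain A c B where AB: "\<alpha> \<oplus> [1] \<oplus> \<beta> = A @ c # B" "order_iso A \<alpha>" "order_iso B \<beta>"
      "\<forall>a\<in>set A. a < c" "\<forall>b\<in>set B. c < b"
    using order_iso_refl[of "\<alpha> \<oplus> [1] \<oplus> \<beta>"] unfolding order_iso_sum_one_sum_iff[OF assms(1,3)] by blast
  have ne: "A \<noteq> []" "B \<noteq> []" using AB(2,3) assms by (auto simp: order_iso_def)
  have dAB: "distinct A" "distinct B" using \<phi> AB(1) by (auto simp: is_perm_def)
  obtain xs where xs: "subseq xs (\<alpha> \<oplus> [1] \<oplus> \<beta>)" "order_iso xs \<psi>"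
    using assms(5) by (auto simp: perm_le_def)
  have "subseq xs ([] @ A @ c # B @ [])" using xs(1) AB(1) by simp
  moreover have "separated (set [] \<union> set []) (set (A @ c # B))" by (simp add: separated_def)
  ultimately show thesis
    using AB(4,5) ne
  proof (cases rule: subseq_through_middle)
    case (avoid ys)
    have "\<forall>a\<in>set A. \<forall>b\<in>set B. a < b" using AB(4,5) less_trans by blast
    then have "order_iso (A @ B) (\<alpha> \<oplus> \<beta>)"
      using AB(2,3) unfolding order_iso_direct_sum_iff[OF assms(1,3)] by blast
    moreover have "subseq ys (A @ B)" "order_iso ys \<psi>"
      using avoid xs(2) order_iso_trans by auto
    ultimately have "\<psi> \<preceq> \<alpha> \<oplus> \<beta>"
      using perm_le_iff_of_order_iso[OF \<psi> is_perm_direct_sum[OF assms(1,3)]] by blast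
    then show thesis using assms(6) by blast
  next
    case (middle P' A' B' S')
    obtain \<alpha>' where \<alpha>': "\<alpha>' \<preceq> \<alpha>" "is_perm \<alpha>'" "\<alpha>' \<noteq> []" "order_iso A' \<alpha>'"
      using subseq_pattern[OF middle(3) AB(2) assms(1) dAB(1) middle(6)] .
    obtain \<beta>' where \<beta>': "\<beta>' \<preceq> \<beta>" "is_perm \<beta>'" "\<beta>' \<noteq> []" "order_iso B' \<beta>'"
      using subseq_pattern[OF middle(4) AB(3) assms(3) dAB(2) middle(7)] .
    have sets: "set A' \<subseteq> set A" "set B' \<subseteq> set B" using middle by (auto elim: list_emb_set)
    have "xs = A' @ c # B'" using middle(1,2,5) by (auto dest: list_emb_Nil2)
    then have "order_iso xs (\<alpha>' \<oplus> [1] \<oplus> \<beta>')"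
      using \<alpha>'(4) \<beta>'(4) sets AB(4,5)
      unfolding order_iso_sum_one_sum_iff[OF \<alpha>'(2) \<beta>'(2)] by blast
    then have "order_iso \<psi> (\<alpha>' \<oplus> [1] \<oplus> \<beta>')" using xs(2) order_iso_sym order_iso_trans by blast
    moreover have "is_perm (\<alpha>' \<oplus> [1] \<oplus> \<beta>')"
      using is_perm_direct_sum[OF \<alpha>'(2) is_perm_direct_sum[OF one \<beta>'(2)]] .
    ultimately have "\<psi> = \<alpha>' \<oplus> [1] \<oplus> \<beta>'" using order_iso_perm_eq \<psi> by blast
    then show thesis using that \<alpha>' \<beta>' by blast
  qed
qed

lemma direct_sum_le_sum_one_sum:
  assumes "is_perm \<alpha>" "is_perm \<beta>"
  shows "\<alpha> \<oplus> \<beta> \<preceq> \<alpha> \<oplus> [1] \<oplus> \<beta>"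
proof -
  have one: "is_perm [1]" by (simp add: is_perm_def)
  obtain A c B where AB: "\<alpha> \<oplus> [1] \<oplus> \<beta> = A @ c # B" "order_iso A \<alpha>" "order_iso B \<beta>"
      "\<forall>a\<in>set A. a < c" "\<forall>b\<in>set B. c < b"
    using order_iso_refl[of "\<alpha> \<oplus> [1] \<oplus> \<beta>"] unfolding order_iso_sum_one_sum_iff[OF assms] by blast
  have "subseq (A @ B) (A @ c # B)" by (intro list_emb_append_mono) auto
  moreover have "order_iso (A @ B) (\<alpha> \<oplus> \<beta>)"
    using AB(2-5) less_trans unfolding order_iso_direct_sum_iff[OF assms] by blast
  ultimately show ?thesis
    unfolding perm_le_def AB(1)[symmetric]
    using is_perm_direct_sum assms one by blast
qed

theorem proposition33:
  fixes \<sigma> \<alpha> \<beta> :: "nat list"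
  assumes "is_perm \<sigma>" "\<sigma> \<noteq> []"
    and "is_perm \<alpha>" "\<alpha> \<noteq> []"
    and "is_perm \<beta>" "\<beta> \<noteq> []"
    and "\<not> (\<exists>\<alpha>'\<in>perm_icc [1] \<alpha>. \<exists>\<beta>'\<in>perm_icc [1] \<beta>. has_interval_copy \<sigma> (\<alpha>' \<oplus> \<beta>'))"
  shows "narrow \<sigma> (\<alpha> \<oplus> [1] \<oplus> \<beta>) \<and>
         is_core \<sigma> (\<alpha> \<oplus> [1] \<oplus> \<beta>) (\<alpha> \<oplus> \<beta>) \<and>
         annihilator \<sigma> (\<alpha> \<oplus> [1] \<oplus> \<beta>)"
proof -
  have avoids: "avoids_sum_copies \<sigma> \<alpha> \<beta>"
    using assms(7) has_interval_copy_iff_has_block[OF assms(1)]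
    unfolding avoids_sum_copies_def by blast
  have core: "is_core \<sigma> (\<alpha> \<oplus> [1] \<oplus> \<beta>) (\<alpha> \<oplus> \<beta>)"
    unfolding is_core_def
  proof (intro conjI ballI)
    show "\<alpha> \<oplus> \<beta> \<preceq> \<alpha> \<oplus> [1] \<oplus> \<beta>" using direct_sum_le_sum_one_sum assms by blast
    show "length (\<alpha> \<oplus> [1] \<oplus> \<beta>) = Suc (length (\<alpha> \<oplus> \<beta>))" by (simp add: direct_sum_def)
    fix \<psi> assume "\<psi> \<in> perm_ico [1] (\<alpha> \<oplus> [1] \<oplus> \<beta>) - perm_icc [1] (\<alpha> \<oplus> \<beta>)"
    then have "\<psi> \<preceq> \<alpha> \<oplus> [1] \<oplus> \<beta>" "\<not> \<psi> \<preceq> \<alpha> \<oplus> \<beta>"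
      by (auto simp: perm_ico_def perm_icc_def)
    then obtain \<alpha>' \<beta>' where \<psi>: "\<psi> = \<alpha>' \<oplus> [1] \<oplus> \<beta>'" "\<alpha>' \<preceq> \<alpha>" "\<alpha>' \<noteq> []" "\<beta>' \<preceq> \<beta>" "\<beta>' \<noteq> []"
      using pattern_of_sum_one_sum[OF assms(3-6)] by metis
    then show "annihilator \<sigma> \<psi>"
      using annihilator_sum_one_sum avoids_sum_copies_mono[OF avoids]
      by (simp add: perm_le_def)
  qed
  then show ?thesis
    using annihilator_sum_one_sum[OF assms(3-6) avoids] narrow_def by blast
qed

end
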